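(* Suppose that $\mathbf{P}\in\mathbb{P}\mathrm{iez}$ has no plane symmetry and has exactly one axial symmetry $\mathbf{r}(\mathbf{n},\pi)$, with $\mathbf{n}\in\mathbb{R}^3$ a unit vector. Then: - if $\mathbf{r}\left(\mathbf{n},\frac{\pi}{2}\right)\star\mathbf{P}=\mathbf{P}$, then the symmetry class of $\mathbf{P}$ is $[\mathrm{SO}(2)]$; - if $\mathbf{r}\left(\mathbf{n},\frac{\pi}{2}\right)\star\mathbf{P}=-\mathbf{P}$, then the symmetry class of $\mathbf{P}$ is $[\mathbb{Z}_4^{-}]$; - otherwise, the symmetry class of $\mathbf{P}$ is $[\mathbb{Z}_2]$.
   Context: $\mathbb{P}\mathrm{iez}$ is the real vector space of piezoelectricity tensors $\{\mathbf{P}\in\otimes^3(\mathbb{R}^3): P_{ijk}=P_{ikj}\}$ (components in an orthonormal basis). The group $\mathrm{O}(3)$ acts on it by $(g\star\mathbf{P})_{ijk}=g_{ip}g_{jq}g_{kr}P_{pqr}$ (summation over repeated indices). The symmetry group of $\mathbf{P}$ is $G_{\mathbf{P}}=\{g\in\mathrm{O}(3): g\star\mathbf{P}=\mathbf{P}\}$, and its symmetry class is the conjugacy class $[G_{\mathbf{P}}]=\{gG_{\mathbf{P}}g^{-1}: g\in\mathrm{O}(3)\}$. For a subgroup $H$, $[H]$ denotes its conjugacy class in $\mathrm{O}(3)$. For a unit vector $\mathbf{n}$, $\mathbf{r}(\mathbf{n},\theta)$ is the rotation of angle $\theta$ about the axis generated by $\mathbf{n}$, and $\mathbf{s}(\mathbf{n})=-\mathbf{r}(\mathbf{n},\pi)$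 is the reflection through the plane orthogonal to $\mathbf{n}$. A plane (resp. axial) symmetry of $\mathbf{P}$ is an element $g$ of the form $\mathbf{s}(\mathbf{n})$ (resp. $\mathbf{r}(\mathbf{n},\pi)$) with $g\star\mathbf{P}=\mathbf{P}$. With $\mathbf{e}_3$ the third canonical basis vector: $\mathbb{Z}_2$ is generated by $\mathbf{r}(\mathbf{e}_3,\pi)$; $\mathbb{Z}_4^{-}$ is generated by $-\mathbf{r}(\mathbf{e}_3,\pi/2)$; $\mathrm{SO}(2)$ is the group of all rotations about $\mathbf{e}_3$. *)

theory Defs
  imports "HOL-Analysis.Analysis" "HOL-Algebra.Generated_Groups"
begin

definition Piez :: "(real^3^3^3) set" where
  "Piez = {P. \<forall>i j k. P $ i $ j $ k = P $ i $ k $ j}"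

lemma subspace_Piez: "subspace Piez"
  by (auto simp: Piez_def subspace_def)

definition O3 :: "(real^3^3) monoid" where
  "O3 = \<lparr>carrier = {g. orthogonal_matrix g}, mult = (**), one = mat 1\<rparr>"

lemma group_O3: "group O3"
proof (rule groupI)
  fix x assume "x \<in> carrier O3"
  then show "\<exists>y\<in>carrier O3. y \<otimes>\<^bsub>O3\<^esub> x = \<one>\<^bsub>O3\<^esub>"
    by (intro bexI[of _ "transpose x"])
       (auto simp: O3_def orthogonal_matrix_def)
qed (auto simp: O3_def orthogonal_matrix_mul orthogonal_matrix_id matrix_mul_assoc)

definition tensor_act :: "real^3^3 \<Rightarrow> real^3^3^3 \<Rightarrow> real^3^3^3" where
  "tensor_act g P = (\<chi> i j k. \<Sum>p\<in>UNIV. \<Sum>q\<in>UNIV. \<Sum>r\<in>UNIV.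
     g $ i $ p * g $ j $ q * g $ k $ r * P $ p $ q $ r)"

definition symmetry_group :: "real^3^3^3 \<Rightarrow> (real^3^3) set" where
  "symmetry_group P = {g \<in> carrier O3. tensor_act g P = P}"

definition conjugacy_class :: "(real^3^3) set \<Rightarrow> (real^3^3) set set" where
  "conjugacy_class H = {(\<lambda>h. g \<otimes>\<^bsub>O3\<^esub> h \<otimes>\<^bsub>O3\<^esub> inv\<^bsub>O3\<^esub> g) ` H | g. g \<in> carrier O3}"

definition symmetry_class :: "real^3^3^3 \<Rightarrow> (real^3^3) set set" where
  "symmetry_class P = conjugacy_class (symmetry_group P)"

text \<open>Rodrigues' formula: for a unit vector \<open>n\<close>, the rotation of angle \<open>\<theta>\<close> about the
  axis generated by \<open>n\<close>, counterclockwise when seen from the tip of \<open>n\<close>.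
  The definition is meaningful only when \<open>norm n = 1\<close>.\<close>
definition rot :: "real^3 \<Rightarrow> real \<Rightarrow> real^3^3" where
  "rot n \<theta> = matrix (\<lambda>v. cos \<theta> *\<^sub>R v + sin \<theta> *\<^sub>R cross3 n v + ((1 - cos \<theta>) * (n \<bullet> v)) *\<^sub>R n)"

definition refl_plane :: "real^3 \<Rightarrow> real^3^3" where
  "refl_plane n = - rot n pi"

definition plane_symmetry :: "real^3^3^3 \<Rightarrow> real^3^3 \<Rightarrow> bool" where
  "plane_symmetry P g \<longleftrightarrow> (\<exists>n. norm n = 1 \<and> g = refl_plane n) \<and> tensor_act g P = P"

definition axial_symmetry :: "real^3^3^3 \<Rightarrow> real^3^3 \<Rightarrow> bool" where
  "axial_symmetry P g \<longleftrightarrow> (\<exists>n. norm n = 1 \<and> g = rot n pi) \<and> tensor_act g P = P"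

definition e3 :: "real^3" where
  "e3 = axis 3 1"

definition Z2 :: "(real^3^3) set" where
  "Z2 = generate O3 {rot e3 pi}"

definition Z4_minus :: "(real^3^3) set" where
  "Z4_minus = generate O3 {- rot e3 (pi / 2)}"

definition SO2 :: "(real^3^3) set" where
  "SO2 = {rot e3 \<theta> | \<theta>. True}"

lemma rot_e3:
  "rot e3 \<theta> = vector [vector [cos \<theta>, - sin \<theta>, 0], vector [sin \<theta>, cos \<theta>, 0], vector [0, 0, 1]]"
  by (simp add: rot_def e3_def matrix_def vec_eq_iff forall_3 cross3_def inner_vec_def
      sum_3 axis_def)

lemma rot_in_O3:
  assumes "norm n = 1"
  shows "rot n \<theta> \<in> carrier O3" "- rot n \<theta> \<in> carrier O3"
proof -
  let ?f = "\<lambda>v. cos \<theta> *\<^sub>R v + sin \<theta> *\<^sub>R cross3 n v + ((1 - cos \<theta>) * (n \<bullet> v)) *\<^sub>R n"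
  have lin: "linear ?f"
    by (rule linearI) (simp_all add: cross_add_right cross_mult_right inner_add_right algebra_simps)
  have nn: "n \<bullet> n = 1"
    using assms by (simp add: norm_eq_1)
  have "?f v \<bullet> ?f v = v \<bullet> v" for v
  proof -
    have d: "cross3 n v \<bullet> cross3 n v = v \<bullet> v - (n \<bullet> v)\<^sup>2"
      using dot_cross[of n v n v] nn by (simp add: power2_eq_square inner_commute)
    have "?f v \<bullet> ?f v = (cos \<theta>)\<^sup>2 * (v \<bullet> v) + (sin \<theta>)\<^sup>2 * (cross3 n v \<bullet> cross3 n v)
        + (1 - cos \<theta>)\<^sup>2 * (n \<bullet> v)\<^sup>2 + 2 * cos \<theta> * (1 - cos \<theta>) * (n \<bullet> v)\<^sup>2"
      by (simp add: inner_add_left inner_add_right dot_cross_self nn inner_commute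
          power2_eq_square algebra_simps)
    also have "\<dots> = ((sin \<theta>)\<^sup>2 + (cos \<theta>)\<^sup>2) * (v \<bullet> v) + (1 - ((sin \<theta>)\<^sup>2 + (cos \<theta>)\<^sup>2)) * (n \<bullet> v)\<^sup>2"
      unfolding d by algebra
    finally show ?thesis by simp
  qed
  then have "orthogonal_transformation ?f"
    using lin by (simp add: orthogonal_transformation norm_eq_sqrt_inner)
  then have o: "orthogonal_matrix (rot n \<theta>)"
    by (simp add: orthogonal_transformation_matrix rot_def)
  then show "rot n \<theta> \<in> carrier O3" by (simp add: O3_def)
  have "transpose (- A) ** (- A) = transpose A ** A" for A :: "real^3^3"
    by (simp add: vec_eq_iff transpose_def matrix_matrix_mult_def)
  with o show "- rot n \<theta> \<in> carrier O3"
    by (simp add: O3_def orthogonal_matrix)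
qed

end

theory Submission
  imports Defs
begin

text \<open>An element of the symmetry group must preserve the axis \<open>n\<close> of the unique axial symmetry, and
  absence of plane symmetries and of other axial symmetries leaves only the elements
  \<open>\<plusminus>r(n,\<theta>)\<close>. The orbit map \<open>\<theta> \<mapsto> r(n,\<theta>) \<star> P\<close> is a trigonometric polynomial of degree at most 3;
  invariance under \<open>r(n,\<pi>)\<close> kills the odd harmonics, so it equals \<open>A + cos 2\<theta> B + sin 2\<theta> C\<close>.
  Whether \<open>A\<close> or \<open>B\<close> vanishes is detected by \<open>r(n,\<pi>/2)\<close>, which sends \<open>P = A + B\<close> to \<open>A - B\<close>,
  and it determines the angles for which \<open>\<plusminus>r(n,\<theta>)\<close> fixes \<open>P\<close>.\<close>

section \<open>The tensor action\<close>

lemma tensor_act_mult: "tensor_act (g ** h) P = tensor_act g (tensor_act h P)"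
proof -
  have "tensor_act (g ** h) P $ i $ j $ k = tensor_act g (tensor_act h P) $ i $ j $ k" for i j k
  proof -
    have expand: "sum a UNIV * sum b UNIV * sum c UNIV * x
        = (\<Sum>p\<in>UNIV. \<Sum>q\<in>UNIV. \<Sum>r\<in>UNIV. a p * b q * c r * x)"
      for a b c :: "3 \<Rightarrow> real" and x
      by (simp only: sum_distrib_left[symmetric] sum_distrib_right[symmetric])
    let ?U = "UNIV :: (3 \<times> 3 \<times> 3) set"
    \<comment> \<open>Each index triple is packed into one index, so that a single
      \<open>sum.swap\<close> exchanges all three inner sums with all three outer ones.\<close>
    have "tensor_act (g ** h) P $ i $ j $ k = (\<Sum>(p,q,r)\<in>?U. \<Sum>(a,b,c)\<in>?U.
        g $ i $ a * h $ a $ p * (g $ j $ b * h $ b $ q) * (g $ k $ c * h $ c $ r) * P $ p $ q $ r)"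
      by (simp add: tensor_act_def matrix_matrix_mult_def expand
          UNIV_Times_UNIV[symmetric] sum.cartesian_product[symmetric] del: UNIV_Times_UNIV)
    also have "\<dots> = (\<Sum>(a,b,c)\<in>?U. \<Sum>(p,q,r)\<in>?U.
        g $ i $ a * h $ a $ p * (g $ j $ b * h $ b $ q) * (g $ k $ c * h $ c $ r) * P $ p $ q $ r)"
      unfolding case_prod_beta by (rule sum.swap)
    also have "\<dots> = tensor_act g (tensor_act h P) $ i $ j $ k"
      by (simp add: tensor_act_def sum_distrib_left mult_ac
          UNIV_Times_UNIV[symmetric] sum.cartesian_product[symmetric] del: UNIV_Times_UNIV)
    finally show ?thesis .
  qed
  then show ?thesis by (simp add: vec_eq_iff)
qed

lemma tensor_act_one: "tensor_act (mat 1) P = P"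
proof -
  have "tensor_act (mat 1) P $ i $ j $ k = P $ i $ j $ k" for i j k
  proof -
    \<comment> \<open>The test on the innermost summation index stands outermost, so the three sums
      collapse one after another.\<close>
    have "tensor_act (mat 1) P $ i $ j $ k = (\<Sum>p\<in>UNIV. \<Sum>q\<in>UNIV. \<Sum>r\<in>UNIV.
        if r = k then if q = j then if p = i then P $ p $ q $ r else 0 else 0 else 0)"
      unfolding tensor_act_def vec_lambda_beta
      by (intro sum.cong refl) (auto simp: mat_def)
    also have "\<dots> = P $ i $ j $ k" by simp
    finally show ?thesis .
  qed
  then show ?thesis by (simp add: vec_eq_iff)
qed

lemma tensor_act_uminus_left: "tensor_act (- g) P = - tensor_act g P"
  by (simp add: tensor_act_def vec_eq_iff sum_negf)

lemma tensor_act_uminus_right: "tensor_act g (- P) = - tensor_act g P"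
  by (simp add: tensor_act_def vec_eq_iff sum_negf)

lemma tensor_act_add: "tensor_act g (P + Q) = tensor_act g P + tensor_act g Q"
  by (simp add: tensor_act_def vec_eq_iff sum.distrib distrib_left)

lemma tensor_act_scaleR: "tensor_act g (c *\<^sub>R P) = c *\<^sub>R tensor_act g P"
  by (simp add: tensor_act_def vec_eq_iff sum_distrib_left mult_ac)

section \<open>Rotations\<close>

lemma matrix_minus_mult_left: "(- A) ** B = - (A ** B)" for A B :: "real^3^3"
  by (simp add: matrix_matrix_mult_def vec_eq_iff sum_negf)

lemma matrix_minus_mult_right: "A ** (- B) = - (A ** B)" for A B :: "real^3^3"
  by (simp add: matrix_matrix_mult_def vec_eq_iff sum_negf)

lemma matrix_vector_minus_left: "(- A) *v x = - (A *v x)" for A :: "real^3^3"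
  by (simp add: matrix_vector_mult_def vec_eq_iff sum_negf)

lemma transpose_uminus: "transpose (- A) = - transpose A" for A :: "real^3^3"
  by (simp add: transpose_def vec_eq_iff)

lemma rot_apply:
  "rot n \<theta> *v v = cos \<theta> *\<^sub>R v + sin \<theta> *\<^sub>R cross3 n v + ((1 - cos \<theta>) * (n \<bullet> v)) *\<^sub>R n"
proof -
  have "linear (\<lambda>v. cos \<theta> *\<^sub>R v + sin \<theta> *\<^sub>R cross3 n v + ((1 - cos \<theta>) * (n \<bullet> v)) *\<^sub>R n)"
    by (rule linearI) (simp_all add: cross_add_right cross_mult_right inner_add_right algebra_simps)
  then show ?thesis
    unfolding rot_def by (simp add: matrix_vector_mul(2)[symmetric] fun_eq_iff)
qed

lemma inner_orthogonal_matrix: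
  fixes g :: "real^'n^'n"
  assumes "orthogonal_matrix g"
  shows "(g *v x) \<bullet> y = x \<bullet> (transpose g *v y)"
  by (metis dot_lmul_matrix inner_commute transpose_matrix_vector)

text \<open>Every term of Rodrigues' formula is equivariant: \<open>h\<close> preserves the inner
  product and, having determinant 1, also the cross product. An improper \<open>h\<close> would
  reverse the angle.\<close>

lemma rot_conj:
  assumes "rotation_matrix h"
  shows "h ** rot n \<theta> ** transpose h = rot (h *v n) \<theta>"
proof -
  have h: "orthogonal_matrix h" and hh: "h ** transpose h = mat 1"
    using assms by (auto simp: rotation_matrix_def orthogonal_matrix_def)
  have "(h ** rot n \<theta> ** transpose h) *v v = rot (h *v n) \<theta> *v v" for v
  proof -
    define w where "w = transpose h *v v"
    have v: "v = h *v w" by (simp add: w_def matrix_vector_mul_assoc hh del: transpose_matrix_vector)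
    have "(h ** rot n \<theta> ** transpose h) *v v = h *v (rot n \<theta> *v w)"
      by (simp add: w_def matrix_vector_mul_assoc matrix_mul_assoc del: transpose_matrix_vector)
    also have "\<dots> = cos \<theta> *\<^sub>R v + sin \<theta> *\<^sub>R cross3 (h *v n) v + ((1 - cos \<theta>) * (n \<bullet> w)) *\<^sub>R (h *v n)"
      by (simp add: rot_apply v cross_rotation_matrix[OF assms] matrix_vector_right_distrib
          matrix_vector_mult_scaleR)
    also have "n \<bullet> w = (h *v n) \<bullet> v"
      by (simp add: w_def inner_orthogonal_matrix[OF h])
    finally show ?thesis by (simp add: rot_apply)
  qed
  then show ?thesis by (simp add: matrix_eq)
qed

text \<open>At angle \<open>pi\<close> the cross product term vanishes, so orthogonality suffices.
  This is what allows arbitrary elements of O(3) to move the axis of an axial symmetry.\<close>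

lemma rot_pi_conj:
  assumes "orthogonal_matrix h"
  shows "h ** rot n pi ** transpose h = rot (h *v n) pi"
proof -
  have hh: "h ** transpose h = mat 1"
    using assms by (auto simp: orthogonal_matrix_def)
  have "(h ** rot n pi ** transpose h) *v v = rot (h *v n) pi *v v" for v
  proof -
    define w where "w = transpose h *v v"
    have v: "v = h *v w" by (simp add: w_def matrix_vector_mul_assoc hh del: transpose_matrix_vector)
    have "(h ** rot n pi ** transpose h) *v v = h *v (rot n pi *v w)"
      by (simp add: w_def matrix_vector_mul_assoc matrix_mul_assoc del: transpose_matrix_vector)
    also have "\<dots> = - v + (2 * (n \<bullet> w)) *\<^sub>R (h *v n)"
      by (simp add: rot_apply v matrix_vector_right_distrib matrix_vector_mult_diff_distrib
          matrix_vector_mult_scaleR)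
    also have "n \<bullet> w = (h *v n) \<bullet> v"
      by (simp add: w_def inner_orthogonal_matrix[OF assms])
    finally show ?thesis by (simp add: rot_apply)
  qed
  then show ?thesis by (simp add: matrix_eq)
qed

section \<open>Reduction to the axis \<open>e3\<close>, composition of rotations, stabilizer of a
  unit vector\<close>

lemma norm_e3: "norm e3 = 1"
  by (simp add: e3_def)

lemma obtain_rotation_from_e3:
  assumes "norm n = 1"
  obtains h where "rotation_matrix h" "h *v e3 = n"
proof -
  obtain f where f: "orthogonal_transformation f" "det (matrix f) = 1" "f e3 = n"
    using rotation_exists_1[OF _ norm_e3 assms] by auto
  show thesis
  proof
    show "rotation_matrix (matrix f)"
      using f by (simp add: rotation_matrix_def orthogonal_transformation_matrix)
    show "matrix f *v e3 = n"
      using f by (simp add: matrix_works orthogonal_transformation_linear)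
  qed
qed

lemma rot_0: "rot n 0 = mat 1"
  by (simp add: matrix_eq rot_apply)

lemma rot_axis: "norm n = 1 \<Longrightarrow> rot n \<theta> *v n = n"
  by (simp add: rot_apply norm_eq_1 algebra_simps)

lemma rot_cong: "cos a = cos b \<Longrightarrow> sin a = sin b \<Longrightarrow> rot n a = rot n b"
  by (simp add: rot_def)

text \<open>Conjugation moves the axis to \<open>e3\<close>, where the claim is the addition theorem
  for sine and cosine on explicit matrices.\<close>

lemma rot_mult:
  assumes "norm n = 1"
  shows "rot n a ** rot n b = rot n (a + b)"
proof -
  obtain h where h: "rotation_matrix h" "h *v e3 = n"
    using obtain_rotation_from_e3[OF assms] .
  then have hh: "transpose h ** h = mat 1"
    by (auto simp: rotation_matrix_def orthogonal_matrix_def)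
  have e: "rot e3 a ** rot e3 b = rot e3 (a + b)"
    by (simp add: rot_e3 vec_eq_iff forall_3 matrix_matrix_mult_def sum_3 cos_add sin_add)
  have "rot n a ** rot n b = h ** rot e3 a ** (transpose h ** h) ** rot e3 b ** transpose h"
    unfolding h(2)[symmetric] rot_conj[OF h(1), symmetric] by (simp only: matrix_mul_assoc)
  also have "\<dots> = rot n (a + b)"
    using h by (simp add: hh matrix_mul_assoc[symmetric] e)
      (simp add: matrix_mul_assoc rot_conj)
  finally show ?thesis .
qed

text \<open>Such a \<open>g\<close> is block diagonal with an orthogonal 2x2 block. Determinant 1 of
  the block gives a rotation about \<open>e3\<close>, determinant -1 a reflection in a plane
  containing \<open>e3\<close>.\<close>

lemma orthogonal_fix_e3:
  assumes g: "orthogonal_matrix g" and e: "g *v e3 = e3"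
  shows "(\<exists>\<theta>. g = rot e3 \<theta>) \<or> (\<exists>m. norm m = 1 \<and> g = - rot m pi)"
proof -
  have "transpose g *v e3 = e3"
    using g e by (metis matrix_vector_mul_assoc matrix_vector_mul_lid orthogonal_matrix_def)
  then have r3: "g$3$1 = 0" "g$3$2 = 0" "g$3$3 = 1"
    by (auto simp: e3_def vec_eq_iff forall_3 transpose_def matrix_vector_mult_def sum_3 axis_def)
  have c3: "g$1$3 = 0" "g$2$3 = 0"
    using e by (auto simp: e3_def vec_eq_iff forall_3 matrix_vector_mult_def sum_3 axis_def)
  have "transpose g ** g = mat 1" using g by (simp add: orthogonal_matrix_def)
  then have eq: "(g$1$1)\<^sup>2 + (g$2$1)\<^sup>2 = 1" "g$1$1 * g$1$2 + g$2$1 * g$2$2 = 0"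
    "(g$1$2)\<^sup>2 + (g$2$2)\<^sup>2 = 1"
    using r3 by (auto simp: vec_eq_iff forall_3 transpose_def matrix_matrix_mult_def sum_3 mat_def
        power2_eq_square)
  obtain t where t: "g$1$1 = cos t" "g$2$1 = sin t"
    using sincos_total_2pi[OF eq(1)] by metis
  define d where "d = g$1$1 * g$2$2 - g$2$1 * g$1$2"
  have "d\<^sup>2 = 1" using eq unfolding d_def by algebra
  then consider "d = 1" | "d = -1" by (auto simp: power2_eq_1_iff)
  then show ?thesis
  proof cases
    case 1
    have "g$1$2 = - g$2$1" "g$2$2 = g$1$1" using 1 eq unfolding d_def by algebra+
    then have "g = rot e3 t"
      by (simp add: rot_e3 vec_eq_iff forall_3 r3 c3 t)
    then show ?thesis by blast
  next
    case 2
    have g2: "g$1$2 = g$2$1" "g$2$2 = - g$1$1" using 2 eq unfolding d_def by algebra+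
    \<comment> \<open>The block now reflects the plane in the line at angle \<open>t/2\<close>;
      \<open>m\<close> is the unit normal of that line, and half-angle formulas identify the
      entries.\<close>
    define m :: "real^3" where "m = vector [- sin (t/2), cos (t/2), 0]"
    have "norm m = 1"
      by (simp add: m_def norm_eq_1 inner_vec_def sum_3 power2_eq_square[symmetric])
    moreover have ht: "cos t = 1 - 2 * (sin (t/2))\<^sup>2" "cos t = 2 * (cos (t/2))\<^sup>2 - 1"
        "sin t = 2 * sin (t/2) * cos (t/2)"
      using cos_double_sin[of "t/2"] cos_double_cos[of "t/2"] sin_double[of "t/2"] by auto
    have "g = - rot m pi"
      by (simp add: rot_def m_def matrix_def vec_eq_iff forall_3 cross3_def inner_vec_def
      sum_3 axis_def r3 c3 g2 t) (use ht in \<open>auto simp: power2_eq_square algebra_simps\<close>)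
    ultimately show ?thesis by blast
  qed
qed

lemma orthogonal_fix_unit:
  assumes g: "orthogonal_matrix g" and n: "norm n = 1" and e: "g *v n = n"
  shows "(\<exists>\<theta>. g = rot n \<theta>) \<or> (\<exists>m. norm m = 1 \<and> g = - rot m pi)"
proof -
  obtain h where h: "rotation_matrix h" "h *v e3 = n"
    using obtain_rotation_from_e3[OF n] .
  then have ho: "orthogonal_matrix h" and hh: "transpose h ** h = mat 1" "h ** transpose h = mat 1"
    by (auto simp: rotation_matrix_def orthogonal_matrix_def)
  define g' where "g' = transpose h ** g ** h"
  have g: "g = h ** g' ** transpose h"
  proof -
    have "h ** g' ** transpose h = (h ** transpose h) ** g ** (h ** transpose h)"
      by (simp only: g'_def matrix_mul_assoc)
    then show ?thesis by (simp add: hh)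
  qed
  have "orthogonal_matrix g'"
    unfolding g'_def by (intro orthogonal_matrix_mul) (simp_all add: ho assms)
  moreover have "g' *v e3 = e3"
    using h(2) e hh by (metis g'_def matrix_vector_mul_assoc matrix_vector_mul_lid)
  ultimately consider t where "g' = rot e3 t" | m where "norm m = 1" "g' = - rot m pi"
    using orthogonal_fix_e3 by blast
  then show ?thesis
  proof cases
    case 1
    then show ?thesis using g rot_conj[OF h(1)] h(2) by auto
  next
    case 2
    have "norm (h *v m) = 1"
      using 2 ho by (simp add: norm_eq_1 inner_orthogonal_matrix matrix_vector_mul_assoc hh)
    moreover have "g = - rot (h *v m) pi"
      by (simp add: g 2 matrix_minus_mult_left matrix_minus_mult_right rot_pi_conj[OF ho])
    ultimately show ?thesis by blast
  qed
qed

section \<open>Harmonics of the orbit map\<close>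

text \<open>The shift by \<open>pi\<close> negates odd harmonics, so the sum is twice the even part
  of \<open>f\<close>. Summing with the shift, rather than assuming period \<open>pi\<close>, makes
  sense for the single terms of the tensor action, which need not be periodic when the whole
  is.\<close>

definition even_harmonic :: "(real \<Rightarrow> real) \<Rightarrow> bool" where
  "even_harmonic f \<longleftrightarrow>
    (\<exists>a b c. \<forall>\<theta>. f \<theta> + f (\<theta> + pi) = a + cos (2 * \<theta>) * b + sin (2 * \<theta>) * c)"

lemma even_harmonic_add:
  assumes "even_harmonic f" "even_harmonic g"
  shows "even_harmonic (\<lambda>\<theta>. f \<theta> + g \<theta>)"
proof -
  obtain a b c a' b' c' where
    "\<And>\<theta>. f \<theta> + f (\<theta> + pi) = a + cos (2 * \<theta>) * b + sin (2 * \<theta>) * c"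
    "\<And>\<theta>. g \<theta> + g (\<theta> + pi) = a' + cos (2 * \<theta>) * b' + sin (2 * \<theta>) * c'"
    using assms unfolding even_harmonic_def by blast
  then have "f \<theta> + g \<theta> + (f (\<theta> + pi) + g (\<theta> + pi))
      = (a + a') + cos (2 * \<theta>) * (b + b') + sin (2 * \<theta>) * (c + c')" for \<theta>
    by (smt (verit) distrib_left)
  then show ?thesis unfolding even_harmonic_def by blast
qed

lemma even_harmonic_sum:
  assumes "\<And>i. i \<in> I \<Longrightarrow> even_harmonic (f i)"
  shows "even_harmonic (\<lambda>\<theta>. \<Sum>i\<in>I. f i \<theta>)"
proof -
  have "even_harmonic (\<lambda>_. 0)"
    unfolding even_harmonic_def by (intro exI[of _ 0]) simp
  with assms show ?thesis
    by (induction I rule: infinite_finite_induct) (simp_all add: even_harmonic_add)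
qed

lemma even_harmonic_cubic:
  "even_harmonic (\<lambda>\<theta>. (cos \<theta> * x1 + sin \<theta> * y1 + z1) * (cos \<theta> * x2 + sin \<theta> * y2 + z2)
    * (cos \<theta> * x3 + sin \<theta> * y3 + z3) * k)"
proof -
  \<comment> \<open>Only products with zero or two trigonometric factors survive, doubled. The
    coefficients come from writing 2 cos^2, 2 sin^2 and 2 sin cos in the double angle.\<close>
  define a where "a = k * (2 * z1 * z2 * z3 + z3 * (x1 * x2 + y1 * y2)
    + z2 * (x1 * x3 + y1 * y3) + z1 * (x2 * x3 + y2 * y3))"
  define b where "b = k * (z3 * (x1 * x2 - y1 * y2) + z2 * (x1 * x3 - y1 * y3)
    + z1 * (x2 * x3 - y2 * y3))"
  define c where "c = k * (z3 * (x1 * y2 + y1 * x2) + z2 * (x1 * y3 + y1 * x3)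
    + z1 * (x2 * y3 + y2 * x3))"
  have "(C * x1 + S * y1 + z1) * (C * x2 + S * y2 + z2) * (C * x3 + S * y3 + z3) * k
      + (- C * x1 + - S * y1 + z1) * (- C * x2 + - S * y2 + z2) * (- C * x3 + - S * y3 + z3) * k
      = a + (C\<^sup>2 - S\<^sup>2) * b + (2 * S * C) * c" if "S\<^sup>2 + C\<^sup>2 = 1" for C S
    using that unfolding a_def b_def c_def by algebra
  from this[OF sin_cos_squared_add] show ?thesis
    unfolding even_harmonic_def
    by (intro exI[of _ a] exI[of _ b] exI[of _ c]) (simp add: cos_double sin_double)
qed

lemma even_harmonic_tensor_act:
  "even_harmonic (\<lambda>\<theta>. tensor_act (rot n \<theta>) P $ i $ j $ k)"
proof -
  obtain X Y Z :: "3 \<Rightarrow> 3 \<Rightarrow> real" where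
    XYZ: "\<And>\<theta> i p. rot n \<theta> $ i $ p = cos \<theta> * X i p + sin \<theta> * Y i p + Z i p"
  proof
    \<comment> \<open>Column \<open>p\<close> of the matrix is Rodrigues' formula at a basis vector;
      collecting the cosine, sine and constant terms fixes \<open>X\<close>, \<open>Y\<close> and
      \<open>Z\<close>.\<close>
    show "rot n \<theta> $ i $ p = cos \<theta> * (axis p 1 $ i - (n \<bullet> axis p 1) * n $ i)
        + sin \<theta> * (cross3 n (axis p 1) $ i) + (n \<bullet> axis p 1) * n $ i" for \<theta> i p
      by (simp add: rot_def matrix_def algebra_simps)
  qed
  show ?thesis
    unfolding tensor_act_def vec_lambda_beta XYZ
    by (intro even_harmonic_sum even_harmonic_cubic)
qed

lemma tensor_act_rot_harmonics:
  assumes n: "norm n = 1" and P: "tensor_act (rot n pi) P = P"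
  obtains A B C where
    "\<And>\<theta>. tensor_act (rot n \<theta>) P = A + cos (2 * \<theta>) *\<^sub>R B + sin (2 * \<theta>) *\<^sub>R C"
proof -
  have "\<exists>a b c. \<forall>\<theta>. tensor_act (rot n \<theta>) P $ i $ j $ k
      = a + cos (2 * \<theta>) * b + sin (2 * \<theta>) * c" for i j k
  proof -
    obtain a b c where abc: "\<And>\<theta>. tensor_act (rot n \<theta>) P $ i $ j $ k
      + tensor_act (rot n (\<theta> + pi)) P $ i $ j $ k = a + cos (2 * \<theta>) * b + sin (2 * \<theta>) * c"
      using even_harmonic_tensor_act[of n P i j k] unfolding even_harmonic_def by blast
    \<comment> \<open>Since the half-turn fixes \<open>P\<close>, the orbit map has period
      \<open>pi\<close>, and its even part is the map itself; the coefficients are just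
      halved.\<close>
    have "tensor_act (rot n (\<theta> + pi)) P = tensor_act (rot n \<theta>) P" for \<theta>
      using P by (simp add: rot_mult[OF n, symmetric] tensor_act_mult)
    with abc have "tensor_act (rot n \<theta>) P $ i $ j $ k
        = a / 2 + cos (2 * \<theta>) * (b / 2) + sin (2 * \<theta>) * (c / 2)" for \<theta>
      by (simp add: field_simps)
    then show ?thesis by blast
  qed
  then obtain a b c where "\<And>i j k \<theta>. tensor_act (rot n \<theta>) P $ i $ j $ k
      = a i j k + cos (2 * \<theta>) * b i j k + sin (2 * \<theta>) * c i j k"
    by metis
  then have "tensor_act (rot n \<theta>) P = (\<chi> i j k. a i j k) + cos (2 * \<theta>) *\<^sub>R (\<chi> i j k. b i j k)
      + sin (2 * \<theta>) *\<^sub>R (\<chi> i j k. c i j k)" for \<theta>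
    by (simp add: vec_eq_iff)
  then show thesis by (rule that)
qed

lemma sin_eq_0_if_cos_pm1:
  fixes x :: real
  assumes "cos x = 1 \<or> cos x = - 1"
  shows "sin x = 0"
proof -
  have "(sin x)\<^sup>2 = 0" unfolding sin_squared_eq using assms by auto
  then show ?thesis by simp
qed

text \<open>The three possibilities for \<open>P = A + B\<close>: \<open>B = 0\<close>, \<open>A = 0 \<noteq> B\<close>, and both nonzero.\<close>

lemma tensor_act_rot_cases:
  assumes n: "norm n = 1" and P: "tensor_act (rot n pi) P = P" and "P \<noteq> 0"
  defines "Q \<equiv> tensor_act (rot n (pi / 2)) P"
  shows "Q = P \<Longrightarrow> tensor_act (rot n \<theta>) P = P"
    and "Q \<noteq> P \<Longrightarrow> tensor_act (rot n \<theta>) P = P \<longleftrightarrow> cos (2 * \<theta>) = 1"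
    and "Q = - P \<Longrightarrow> tensor_act (rot n \<theta>) P = - P \<longleftrightarrow> cos (2 * \<theta>) = - 1"
    and "Q \<noteq> - P \<Longrightarrow> tensor_act (rot n \<theta>) P \<noteq> - P"
proof -
  obtain A B C where
    ABC: "\<And>\<theta>. tensor_act (rot n \<theta>) P = A + cos (2 * \<theta>) *\<^sub>R B + sin (2 * \<theta>) *\<^sub>R C"
    using tensor_act_rot_harmonics[OF n P] by blast
  have PAB: "P = A + B" using ABC[of 0] by (simp add: rot_0 tensor_act_one)
  have QAB: "Q = A - B" using ABC[of "pi/2"] by (simp add: Q_def)
  have two: "X = 0" if "X + X = 0" for X :: "real^3^3^3"
    using that by (metis scaleR_2 scaleR_eq_0_iff zero_neq_numeral)
  \<comment> \<open>If \<open>B = 0\<close>, the quarter-turn fixes \<open>P\<close>, so the orbit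
    map has period \<open>pi/2\<close>. But the sine term changes sign under that shift; comparing
    at \<open>pi/4\<close> removes it.\<close>
  have C0: "C = 0" if "B = 0"
  proof -
    have "tensor_act (rot n (pi/4)) P = tensor_act (rot n (pi/4)) Q"
      using that PAB QAB by simp
    also have "\<dots> = tensor_act (rot n (pi/4 + pi/2)) P"
      by (simp only: Q_def tensor_act_mult[symmetric] rot_mult[OF n])
    finally have "tensor_act (rot n (pi/4)) P = tensor_act (rot n (pi/4 + pi/2)) P" .
    moreover have "cos (2 * (pi/4 + pi/2)) = 0" "sin (2 * (pi/4 + pi/2)) = - 1"
      by (simp_all only: distrib_left cos_add sin_add) simp_all
    ultimately have "A + C = A - C"
      using that ABC[of "pi/4"] ABC[of "pi/4 + pi/2"] by simp
    then show ?thesis using two[of C] by (simp add: algebra_simps)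
  qed
  have B0: "B = 0 \<longleftrightarrow> Q = P"
    using PAB QAB two[of B] by (auto simp: algebra_simps)
  have A0: "A = 0 \<longleftrightarrow> Q = - P"
    using PAB QAB two[of A] by (auto simp: algebra_simps)
  show "Q = P \<Longrightarrow> tensor_act (rot n \<theta>) P = P"
    using B0 C0 PAB ABC by simp
  \<comment> \<open>The sign \<open>s\<close> covers \<open>P\<close> and \<open>- P\<close> at
    once. The inverse rotation then also sends \<open>P\<close> to \<open>s\<close> times
    \<open>P\<close>, while the sine term is odd in the angle, so it vanishes.\<close>
  have AB: "tensor_act (rot n \<theta>) P = A + cos (2 * \<theta>) *\<^sub>R B" if "tensor_act (rot n \<theta>) P = s *\<^sub>R P" "s * s = 1" for s
  proof -
    have "P = tensor_act (rot n (- \<theta>)) (tensor_act (rot n \<theta>) P)"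
      by (simp add: tensor_act_mult[symmetric] rot_mult[OF n] rot_0 tensor_act_one)
    also have "\<dots> = s *\<^sub>R tensor_act (rot n (- \<theta>)) P"
      using that by (simp add: tensor_act_scaleR)
    finally have "s *\<^sub>R P = tensor_act (rot n (- \<theta>)) P"
      using that(2) by (metis scaleR_one scaleR_scaleR)
    then have "A + cos (2 * \<theta>) *\<^sub>R B + sin (2 * \<theta>) *\<^sub>R C = A + cos (2 * \<theta>) *\<^sub>R B - sin (2 * \<theta>) *\<^sub>R C"
      using that(1) ABC[of \<theta>] ABC[of "- \<theta>"] by simp
    then have "sin (2 * \<theta>) *\<^sub>R C = 0"
      using two[of "sin (2 * \<theta>) *\<^sub>R C"] by (simp add: algebra_simps)
    then show ?thesis using ABC[of \<theta>] by (simp only: add_0_right)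
  qed
  note sin0 = sin_eq_0_if_cos_pm1[of "2 * \<theta>"]
  show "tensor_act (rot n \<theta>) P = P \<longleftrightarrow> cos (2 * \<theta>) = 1" if "Q \<noteq> P"
  proof
    assume "tensor_act (rot n \<theta>) P = P"
    then have "A + cos (2 * \<theta>) *\<^sub>R B = A + B"
      using AB[of 1] PAB by simp
    then have "(cos (2 * \<theta>) - 1) *\<^sub>R B = 0" by (simp add: scaleR_left_diff_distrib)
    then show "cos (2 * \<theta>) = 1"
      using B0 that by auto
  next
    assume "cos (2 * \<theta>) = 1"
    then show "tensor_act (rot n \<theta>) P = P" using ABC[of \<theta>] PAB sin0 by simp
  qed
  have neg: "A = 0 \<and> cos (2 * \<theta>) = - 1" if *: "tensor_act (rot n \<theta>) P = - P"
  proof -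
    have e1: "A + cos (2 * \<theta>) *\<^sub>R B = - A + - B"
      using AB[of "-1"] * PAB by simp
    \<comment> \<open>The quarter-turn exchanges \<open>P\<close> and \<open>Q\<close>;
      \<open>A\<close> is half their sum and \<open>B\<close> half their difference.\<close>
    have rA: "tensor_act (rot n (pi/2)) A = A" and rB: "tensor_act (rot n (pi/2)) B = - B"
    proof -
      have "tensor_act (rot n (pi/2)) Q = P"
        using P by (simp add: Q_def tensor_act_mult[symmetric] rot_mult[OF n])
      moreover have "A = (1/2) *\<^sub>R (P + Q)" "B = (1/2) *\<^sub>R (P + - Q)"
        by (simp_all add: PAB QAB scaleR_2[symmetric])
      ultimately show "tensor_act (rot n (pi/2)) A = A" "tensor_act (rot n (pi/2)) B = - B"
        by (simp_all only: tensor_act_scaleR tensor_act_add tensor_act_uminus_right Q_def[symmetric])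
          (simp_all add: algebra_simps)
    qed
    \<comment> \<open>Applying the quarter-turn to \<open>e1\<close> only flips \<open>B\<close>.
      Adding both equations eliminates \<open>B\<close> and leaves
      \<open>A + A = - (A + A)\<close>.\<close>
    have "A + cos (2 * \<theta>) *\<^sub>R (- B) = - A + - (- B)"
      using arg_cong[OF e1, of "tensor_act (rot n (pi/2))"]
      by (simp only: tensor_act_add tensor_act_scaleR tensor_act_uminus_right rA rB)
    with e1 have "(A + cos (2 * \<theta>) *\<^sub>R B) + (A + cos (2 * \<theta>) *\<^sub>R (- B))
        = (- A + - B) + (- A + - (- B))" by (simp only:)
    then have "A + A = - (A + A)" by simp
    then have "(A + A) + (A + A) = 0" by (rule eq_neg_iff_add_eq_0[THEN iffD1])
    then have A: "A = 0" by (rule two[OF two])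
    with \<open>P \<noteq> 0\<close> PAB have "B \<noteq> 0" by auto
    moreover have "(cos (2 * \<theta>) + 1) *\<^sub>R B = 0" using e1 A by (simp add: algebra_simps)
    ultimately show ?thesis using A by auto
  qed
  show "Q \<noteq> - P \<Longrightarrow> tensor_act (rot n \<theta>) P \<noteq> - P"
    using neg A0 by blast
  show "tensor_act (rot n \<theta>) P = - P \<longleftrightarrow> cos (2 * \<theta>) = - 1" if "Q = - P"
    using neg that A0 ABC[of \<theta>] PAB sin0 by auto
qed

section \<open>Subgroups and conjugacy\<close>

lemma inv_O3: "orthogonal_matrix g \<Longrightarrow> inv\<^bsub>O3\<^esub> g = transpose g"
  by (rule group.inv_equality[OF group_O3]) (auto simp: O3_def orthogonal_matrix_def)

lemma conjugacy_class_conj: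
  assumes h: "orthogonal_matrix h"
  shows "conjugacy_class ((\<lambda>x. h ** x ** transpose h) ` K) = conjugacy_class K"
proof -
  define c where "c g x = g ** x ** transpose g" for g x :: "real^3^3"
  have cc: "conjugacy_class H = {c g ` H |g. orthogonal_matrix g}" for H
  proof -
    have "(\<lambda>x. g \<otimes>\<^bsub>O3\<^esub> x \<otimes>\<^bsub>O3\<^esub> inv\<^bsub>O3\<^esub> g) = c g" if "orthogonal_matrix g" for g :: "real^3^3"
      using inv_O3[OF that] by (simp add: c_def fun_eq_iff) (simp add: O3_def)
    then show ?thesis
      unfolding conjugacy_class_def by (auto simp: O3_def[THEN arg_cong[of _ _ carrier]]) metis+
  qed
  have c_c: "c g ` c k ` H = c (g ** k) ` H" for g k :: "real^3^3" and H
    by (simp add: c_def image_image matrix_mul_assoc matrix_transpose_mul)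
  \<comment> \<open>Right multiplication by \<open>h\<close> permutes O(3), so both classes range
    over the same conjugates; \<open>g ** transpose h\<close> is the preimage of
    \<open>g\<close>.\<close>
  have c1: "c (g ** transpose h) ` c h ` K = c g ` K" for g :: "real^3^3"
  proof -
    have "g ** transpose h ** h = g"
      using h by (simp add: orthogonal_matrix_def matrix_mul_assoc[symmetric])
    then show ?thesis by (simp add: c_c)
  qed
  have "conjugacy_class (c h ` K) = conjugacy_class K"
    unfolding cc
  proof (intro equalityI subsetI; clarify)
    fix g :: "real^3^3" assume g: "orthogonal_matrix g"
    show "\<exists>k. c g ` c h ` K = c k ` K \<and> orthogonal_matrix k"
      using orthogonal_matrix_mul[OF g h] c_c by blast
    have "orthogonal_matrix (g ** transpose h)"
      using orthogonal_matrix_mul[OF g] h by simp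
    then show "\<exists>k. c g ` K = c k ` c h ` K \<and> orthogonal_matrix k"
      using c1 by metis
  qed
  then show ?thesis by (simp add: c_def[abs_def])
qed

section \<open>The groups \<open>Z2\<close> and \<open>Z4_minus\<close> as explicit sets of signed
  rotations\<close>

lemma rot_inverse:
  assumes "norm n = 1"
  shows "inv\<^bsub>O3\<^esub> (rot n \<theta>) = rot n (- \<theta>)" "inv\<^bsub>O3\<^esub> (- rot n \<theta>) = - rot n (- \<theta>)"
proof -
  show "inv\<^bsub>O3\<^esub> (rot n \<theta>) = rot n (- \<theta>)"
    by (rule group.inv_equality[OF group_O3])
      (simp_all add: rot_in_O3 assms, simp add: O3_def rot_mult assms rot_0)
  show "inv\<^bsub>O3\<^esub> (- rot n \<theta>) = - rot n (- \<theta>)"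
    by (rule group.inv_equality[OF group_O3])
      (simp_all add: rot_in_O3 assms, simp add: O3_def rot_mult assms rot_0
        matrix_minus_mult_left matrix_minus_mult_right)
qed

lemma rot_cos_double_eq_1:
  assumes "cos (2 * \<theta>) = 1"
  shows "rot n \<theta> = rot n 0 \<or> rot n \<theta> = rot n pi"
proof -
  have s: "sin \<theta> = 0" using assms cos_double_sin[of \<theta>] by simp
  then have "cos \<theta> = 1 \<or> cos \<theta> = - 1"
    using sin_cos_squared_add[of \<theta>] by (simp add: power2_eq_1_iff)
  then show ?thesis using s by (auto intro!: rot_cong)
qed

text \<open>The condition on \<open>cos (2 * \<theta>)\<close> selects the multiples of
  \<open>pi\<close>. It has the form delivered by \<open>tensor_act_rot_cases\<close>, so no angles
  need be enumerated when comparing with a symmetry group.\<close>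

lemma Z2_eq: "Z2 = {rot e3 \<theta> | \<theta>. cos (2 * \<theta>) = 1}" (is "_ = ?S")
proof
  show "Z2 \<subseteq> ?S"
  proof
    fix g assume "g \<in> Z2"
    then show "g \<in> ?S" unfolding Z2_def
    proof (induction rule: generate.induct)
      case one
      have "\<one>\<^bsub>O3\<^esub> = rot e3 0" by (simp add: O3_def rot_0)
      then show ?case by force
    next
      case (incl h)
      then show ?case by auto
    next
      case (inv h)
      then have "inv\<^bsub>O3\<^esub> h = rot e3 (- pi)" by (simp add: rot_inverse norm_e3)
      then show ?case by force
    next
      case (eng h1 h2)
      then obtain a b where ab: "h1 = rot e3 a" "h2 = rot e3 b" "cos (2 * a) = 1" "cos (2 * b) = 1"
        by auto
      have "h1 \<otimes>\<^bsub>O3\<^esub> h2 = rot e3 (a + b)"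
        by (simp add: ab O3_def rot_mult norm_e3)
      moreover have "cos (2 * (a + b)) = 1"
        using ab sin_eq_0_if_cos_pm1 by (simp add: distrib_left cos_add)
      ultimately show ?case by blast
    qed
  qed
  show "?S \<subseteq> Z2"
  proof clarify
    fix \<theta> :: real assume "cos (2 * \<theta>) = 1"
    then have "rot e3 \<theta> = rot e3 0 \<or> rot e3 \<theta> = rot e3 pi"
      by (rule rot_cos_double_eq_1)
    moreover have "rot e3 0 \<in> Z2" using generate.one[of O3] by (simp add: Z2_def O3_def rot_0)
    moreover have "rot e3 pi \<in> Z2" by (simp add: Z2_def generate.incl)
    ultimately show "rot e3 \<theta> \<in> Z2" by auto
  qed
qed

lemma Z4_minus_eq:
  "Z4_minus = {rot e3 \<theta> | \<theta>. cos (2 * \<theta>) = 1} \<union> {- rot e3 \<theta> | \<theta>. cos (2 * \<theta>) = - 1}"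
  (is "_ = ?S")
proof
  show "Z4_minus \<subseteq> ?S"
  proof
    fix g assume "g \<in> Z4_minus"
    then show "g \<in> ?S" unfolding Z4_minus_def
    proof (induction rule: generate.induct)
      case one
      have "\<one>\<^bsub>O3\<^esub> = rot e3 0" by (simp add: O3_def rot_0)
      then show ?case by force
    next
      case (incl h)
      then show ?case by force
    next
      case (inv h)
      then have "inv\<^bsub>O3\<^esub> h = - rot e3 (- (pi / 2))" by (simp add: rot_inverse norm_e3)
      moreover have "cos (2 * (- (pi / 2))) = - 1" by simp
      ultimately show ?case by blast
    next
      case (eng h1 h2)
      \<comment> \<open>The sine of \<open>2 * a\<close> vanishes, so the values 1 and -1 multiply
        exactly as the signs in front of the rotations do; this gives closure.\<close>
      have c: "cos (2 * (a + b)) = cos (2 * a) * cos (2 * b)"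
        if "cos (2 * a) = 1 \<or> cos (2 * a) = - 1" for a b :: real
        using sin_eq_0_if_cos_pm1[OF that] by (simp add: distrib_left cos_add)
      have m: "rot e3 a \<otimes>\<^bsub>O3\<^esub> rot e3 b = rot e3 (a + b)"
        "- rot e3 a \<otimes>\<^bsub>O3\<^esub> rot e3 b = - rot e3 (a + b)"
        "rot e3 a \<otimes>\<^bsub>O3\<^esub> - rot e3 b = - rot e3 (a + b)"
        "- rot e3 a \<otimes>\<^bsub>O3\<^esub> - rot e3 b = rot e3 (a + b)" for a b
        by (simp_all add: O3_def rot_mult norm_e3 matrix_minus_mult_left matrix_minus_mult_right)
      from eng.IH show ?case
      proof (elim UnE CollectE exE conjE)
        fix a b assume "h1 = rot e3 a" "h2 = rot e3 b" "cos (2 * a) = 1" "cos (2 * b) = 1"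
        then show ?thesis using m(1)[of a b] c[of a b] by auto
      next
        fix a b assume "h1 = - rot e3 a" "h2 = rot e3 b" "cos (2 * a) = - 1" "cos (2 * b) = 1"
        then show ?thesis using m(2)[of a b] c[of a b] by auto
      next
        fix a b assume "h1 = rot e3 a" "h2 = - rot e3 b" "cos (2 * a) = 1" "cos (2 * b) = - 1"
        then show ?thesis using m(3)[of a b] c[of a b] by auto
      next
        fix a b assume "h1 = - rot e3 a" "h2 = - rot e3 b" "cos (2 * a) = - 1" "cos (2 * b) = - 1"
        then show ?thesis using m(4)[of a b] c[of a b] by auto
      qed
    qed
  qed
  \<comment> \<open>For the converse, four elements suffice: the generator, its inverse, its square
    \<open>rot e3 pi\<close> and the identity.\<close>
  have q: "- rot e3 (pi / 2) \<in> Z4_minus" by (simp add: Z4_minus_def generate.incl)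
  have "- rot e3 (- (pi / 2)) \<in> Z4_minus"
    using generate.inv[of "- rot e3 (pi / 2)" _ O3]
    by (simp add: Z4_minus_def rot_inverse norm_e3)
  moreover have "rot e3 pi \<in> Z4_minus"
    using generate.eng[OF q[unfolded Z4_minus_def] q[unfolded Z4_minus_def]]
    by (simp add: Z4_minus_def O3_def rot_mult norm_e3 matrix_minus_mult_left matrix_minus_mult_right)
  moreover have "rot e3 0 \<in> Z4_minus"
    using generate.one[of O3] by (simp add: Z4_minus_def O3_def rot_0)
  moreover note rot_cos_double_eq_1[of _ e3]
  moreover have "rot e3 \<theta> = rot e3 (pi / 2) \<or> rot e3 \<theta> = rot e3 (- (pi / 2))"
    if "cos (2 * \<theta>) = - 1" for \<theta>
  proof -
    have s: "cos \<theta> = 0" using that cos_double_cos[of \<theta>] by simp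
    then have "sin \<theta> = 1 \<or> sin \<theta> = - 1"
      using sin_cos_squared_add[of \<theta>] by (simp add: power2_eq_1_iff)
    then show ?thesis using s rot_cong[of \<theta> "pi/2"] rot_cong[of \<theta> "- (pi/2)"] by auto
  qed
  ultimately show "?S \<subseteq> Z4_minus" using q by auto metis+
qed

section \<open>The symmetry group\<close>

text \<open>A symmetry \<open>g\<close> conjugates the half-turn about \<open>n\<close> to the
  half-turn about \<open>g *v n\<close>, again a symmetry of \<open>P\<close>. Uniqueness forces
  \<open>g *v n\<close> to be \<open>n\<close> or \<open>- n\<close>, so \<open>g\<close> or
  \<open>- g\<close> fixes \<open>n\<close> and is classified by
  \<open>orthogonal_fix_unit\<close>.\<close>

lemma symmetry_group_unique_axis:
  assumes n: "norm n = 1"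
    and pl: "\<not> (\<exists>g. plane_symmetry P g)"
    and ax: "{g. axial_symmetry P g} = {rot n pi}"
  shows "symmetry_group P = {rot n \<theta> | \<theta>. tensor_act (rot n \<theta>) P = P}
    \<union> {- rot n \<theta> | \<theta>. tensor_act (rot n \<theta>) P = - P}"
proof -
  have nopl: "tensor_act (- rot m pi) P \<noteq> P" if "norm m = 1" for m
    using pl that unfolding plane_symmetry_def refl_plane_def by blast
  have axu: "rot m pi = rot n pi" if "norm m = 1" "tensor_act (rot m pi) P = P" for m
    using ax that unfolding axial_symmetry_def by blast
  have P: "tensor_act (rot n pi) P = P"
    using ax unfolding axial_symmetry_def by blast
  have "g \<in> {rot n \<theta> | \<theta>. tensor_act (rot n \<theta>) P = P}
    \<union> {- rot n \<theta> | \<theta>. tensor_act (rot n \<theta>) P = - P}"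
    if o: "orthogonal_matrix g" and gP: "tensor_act g P = P" for g
  proof -
    have gg: "transpose g ** g = mat 1" using o by (simp add: orthogonal_matrix_def)
    have ng: "norm (g *v n) = 1"
      using n o by (simp add: norm_eq_1 inner_orthogonal_matrix matrix_vector_mul_assoc gg)
    have "tensor_act (transpose g) P = P"
      using gP gg by (metis tensor_act_mult tensor_act_one)
    then have "tensor_act (rot (g *v n) pi) P = P"
      using gP P by (simp add: rot_pi_conj[OF o, symmetric] tensor_act_mult)
    then have "rot (g *v n) pi *v n = n"
      using axu[OF ng] rot_axis[OF n] by simp
    \<comment> \<open>The half-turn about \<open>g *v n\<close> fixes \<open>n\<close>; written out
      by Rodrigues' formula this makes \<open>n\<close> a multiple of the unit vector
      \<open>g *v n\<close>.\<close>
    then have "(2 * ((g *v n) \<bullet> n)) *\<^sub>R (g *v n) = 2 *\<^sub>R n"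
      by (simp add: rot_apply scaleR_2 algebra_simps)
    then have e: "((g *v n) \<bullet> n) *\<^sub>R (g *v n) = n"
      by (metis scaleR_scaleR scaleR_cancel_left zero_neq_numeral)
    then have "\<bar>(g *v n) \<bullet> n\<bar> = 1"
      using ng n by (metis norm_scaleR mult.right_neutral)
    then consider "g *v n = n" | "g *v n = - n"
    proof (cases "(g *v n) \<bullet> n = 1")
      case False
      then have "(g *v n) \<bullet> n = - 1" using \<open>\<bar>(g *v n) \<bullet> n\<bar> = 1\<close> by linarith
      then show thesis using e that(2) by (metis minus_minus scaleR_minus1_left)
    qed (use e that(1) in simp)
    then show ?thesis
    proof cases
      case 1
      then consider t where "g = rot n t" | m where "norm m = 1" "g = - rot m pi"
        using orthogonal_fix_unit[OF o n] by blast
      then show ?thesis using gP nopl by cases auto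
    next
      case 2
      have "orthogonal_matrix (- g)"
        using o by (simp add: orthogonal_matrix_def transpose_uminus matrix_minus_mult_left
            matrix_minus_mult_right)
      moreover have "(- g) *v n = n" using 2 by (simp add: matrix_vector_minus_left)
      ultimately consider t where "- g = rot n t" | m where "norm m = 1" "- g = - rot m pi"
        using orthogonal_fix_unit[OF _ n] by blast
      then show ?thesis
      proof cases
        case 1
        then have "g = - rot n t" by (metis minus_minus)
        moreover from this have "tensor_act (rot n t) P = - P"
          using gP by (metis tensor_act_uminus_left minus_minus)
        ultimately show ?thesis by blast
      next
        case m: 2
        \<comment> \<open>Here \<open>g\<close> itself is a half-turn fixing \<open>P\<close>, hence
          the only one available, which already lies in the first set.\<close>
        then have "g = rot n pi" using axu gP by auto
        then have "g *v n = n" by (simp add: rot_axis n)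
        with gP P \<open>g = rot n pi\<close> show ?thesis by blast
      qed
    qed
  qed
  then show ?thesis
    using rot_in_O3[OF n]
    by (auto simp: symmetry_group_def tensor_act_uminus_left O3_def)
qed

theorem lemma4p6:
  fixes P :: "real^3^3^3" and n :: "real^3"
  assumes "P \<in> Piez"
    and "norm n = 1"
    and "\<not> (\<exists>g. plane_symmetry P g)"
    and "{g. axial_symmetry P g} = {rot n pi}"
  shows "(tensor_act (rot n (pi / 2)) P = P \<longrightarrow> symmetry_class P = conjugacy_class SO2)
    \<and> (tensor_act (rot n (pi / 2)) P = - P \<longrightarrow> symmetry_class P = conjugacy_class Z4_minus)
    \<and> (tensor_act (rot n (pi / 2)) P \<noteq> P \<and> tensor_act (rot n (pi / 2)) P \<noteq> - P \<longrightarrow>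
        symmetry_class P = conjugacy_class Z2)"
proof -
  note n = assms(2)
  have P: "tensor_act (rot n pi) P = P"
    using assms(4) unfolding axial_symmetry_def by blast
  \<comment> \<open>The half-turn fixes \<open>P\<close>, so the reflection
    \<open>- rot n pi\<close> sends \<open>P\<close> to \<open>- P\<close>. The absence of plane
    symmetries therefore rules out \<open>P = 0\<close>.\<close>
  have "tensor_act (- rot n pi) P \<noteq> P"
    using assms(3) n unfolding plane_symmetry_def refl_plane_def by blast
  then have P0: "P \<noteq> 0" using P by (auto simp: tensor_act_uminus_left)
  then have PmP: "P \<noteq> - P"
    by (metis add.right_inverse scaleR_2 scaleR_eq_0_iff zero_neq_numeral)
  note G = symmetry_group_unique_axis[OF n assms(3,4)]
  note cases = tensor_act_rot_cases[OF n P P0]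
  obtain h where h: "rotation_matrix h" "h *v e3 = n"
    using obtain_rotation_from_e3[OF n] .
  \<comment> \<open>Conjugation by \<open>h\<close> carries signed rotations about \<open>e3\<close>
    to those about \<open>n\<close> with the same angle, so it remains to write the symmetry group
    as the image under \<open>c\<close> of a standard group.\<close>
  define c where "c x = h ** x ** transpose h" for x
  have c: "c (rot e3 \<theta>) = rot n \<theta>" "c (- rot e3 \<theta>) = - rot n \<theta>" for \<theta>
    using rot_conj[OF h(1)] h(2)
    by (simp_all add: c_def matrix_minus_mult_left matrix_minus_mult_right)
  have c_image: "c ` {rot e3 \<theta> |\<theta>. p \<theta>} = {rot n \<theta> |\<theta>. p \<theta>}"
    "c ` {- rot e3 \<theta> |\<theta>. p \<theta>} = {- rot n \<theta> |\<theta>. p \<theta>}" for p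
    by (simp_all add: setcompr_eq_image image_image c)
  have cl: "symmetry_class P = conjugacy_class K" if "symmetry_group P = c ` K" for K
    using that conjugacy_class_conj[of h K] h(1)
    by (simp add: symmetry_class_def c_def[abs_def] rotation_matrix_def)
  show ?thesis
  proof (intro conjI impI)
    assume Q: "tensor_act (rot n (pi / 2)) P = P"
    have "symmetry_group P = {rot n \<theta> | \<theta>. True}"
      \<comment> \<open>Every rotation about \<open>n\<close> fixes \<open>P\<close>, so none sends
        it to \<open>- P\<close> and the second part of the group is empty.\<close>
      unfolding G using cases(1)[OF Q] PmP by auto
    also have "\<dots> = c ` SO2"
      by (simp only: SO2_def c_image)
    finally show "symmetry_class P = conjugacy_class SO2" by (rule cl)
  next
    assume Q: "tensor_act (rot n (pi / 2)) P = - P"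
    have "symmetry_group P = {rot n \<theta> | \<theta>. cos (2 * \<theta>) = 1} \<union> {- rot n \<theta> | \<theta>. cos (2 * \<theta>) = - 1}"
      unfolding G using cases(2,3) Q PmP by auto
    also have "\<dots> = c ` Z4_minus"
      by (simp only: Z4_minus_eq image_Un c_image)
    finally show "symmetry_class P = conjugacy_class Z4_minus" by (rule cl)
  next
    assume Q: "tensor_act (rot n (pi / 2)) P \<noteq> P \<and> tensor_act (rot n (pi / 2)) P \<noteq> - P"
    have "symmetry_group P = {rot n \<theta> | \<theta>. cos (2 * \<theta>) = 1}"
      \<comment> \<open>No rotation about \<open>n\<close> sends \<open>P\<close> to
        \<open>- P\<close>, so only the half-turn and the identity remain.\<close>
      unfolding G using cases(2,4) Q by auto
    also have "\<dots> = c ` Z2"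
      by (simp only: Z2_eq c_image)
    finally show "symmetry_class P = conjugacy_class Z2" by (rule cl)
  qed
qed

end
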